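(* In every data market instance with discretized piecewise-linear convex (PLC) pricing, as described in the context, there exists a strategy profile $\ell^*=(\ell^*_1,\dots,\ell^*_m)\in\prod_{j=1}^m\Delta_{m_j}$ such that no seller can increase her revenue by more than a factor of 2 by deviating to a linear pricing strategy; formally, for each seller $j\in[m]$, $$\max_{k\in[m_j]} r_j(\mathbf{e}^{(k)},\ell^*_{-j})\le 2\,r_j(\ell^* ).$$
   Context: Notation: $[t]=\{1,\dots,t\}$; $\Delta_d=\{x\in\mathbb{R}_{\ge0}^d:\sum_i x_i=1\}$; $\mathbf{e}^{(k)}$ is the $k$-th standard unit vector. Market. There are $n$ buyers and $m$ sellers, seller $j$ owning dataset $j$ (divisible and non-rivalrous: every buyer can buy any fraction of it regardless of what others buy). Buyer $i$ has budget $b_i\ge0$ and value $\tau_{i,j}\ge0$ for dataset $j$; her utility for fractions $(z_1,\dots,z_m)\in[0,1]^m$ is $\sum_j\tau_{i,j}z_j$. Discretized PLC pricing. Each seller $j$ is given a finite nonempty set of prices $P_j=\{p_{j,1}<\dots<p_{j,m_j}\}\subset\mathbb{R}_{>0}$. Her strategy is a vector $\ell_j=(\ell_{j,1},\dots,\ell_{j,m_j})\in\Delta_{m_j}$: dataset $j$ is divided into shards, where shard $k$ has size $\ell_{j,k}$ and price $p_{j,k}$ per unit, so buying an amount $y\le\ell_{j,k}$ of shard $(j,k)$ costs $p_{j,k}y$. The strategy $\mathbf{e}^{(k)}$ is the linear (uniform) price $p_{j,k}$. A profile is $\ell=(\ell_1,\dots,\ell_m)$, and $(\ell'_j,\ell_{-j})$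 is the profile with $\ell_j$ replaced by $\ell'_j$. Buyer behavior. Each buyer $i$ has a fixed ordering $\sigma_i$ (not depending on $\ell$) of all pairs $(j,k)$, in non-increasing order of bang-per-buck $\tau_{i,j}/p_{j,k}$ (ties ordered arbitrarily but fixed). She goes through the shards in the order $\sigma_i$, buying as much of each shard as possible before moving to the next, until her budget is exhausted or she has bought all shards of datasets of positive value; she never buys from datasets $j$ with $\tau_{i,j}=0$. The revenue $r_j(\ell)$ is the total payment seller $j$ receives from all buyers. *)

theory Defs
  imports "HOL-Analysis.Analysis"
begin

(* Vectors of varying dimension d are functions on the natural numbers; the coordinates
   are 1, ..., d and all other values are 0, so that a vector is determined by its
   coordinates. *)

definition strategy_simplex :: "nat \<Rightarrow> (nat \<Rightarrow> real) set" where
  "strategy_simplex d = {x. (\<forall>k. 0 \<le> x k) \<and> (\<forall>k. k \<notin> {1..d} \<longrightarrow> x k = 0) \<and> (\<Sum>k=1..d. x k) = 1}"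

definition unit_vec :: "nat \<Rightarrow> nat \<Rightarrow> real" where
  "unit_vec k = (\<lambda>i. if i = k then 1 else 0)"

(* Buyers are 1, ..., n and sellers are 1, ..., m. Buyer i has budget b i, value \<tau> i j for
   dataset j and shard ordering \<sigma> i. Seller j has the prices p j 1 < ... < p j (K j). *)

locale data_market =
  fixes n m :: nat
    and b :: "nat \<Rightarrow> real"
    and \<tau> :: "nat \<Rightarrow> nat \<Rightarrow> real"
    and K :: "nat \<Rightarrow> nat"
    and p :: "nat \<Rightarrow> nat \<Rightarrow> real"
    and \<sigma> :: "nat \<Rightarrow> (nat \<times> nat) list"
  assumes budget_nonneg: "i \<in> {1..n} \<Longrightarrow> 0 \<le> b i"
    and value_nonneg: "i \<in> {1..n} \<Longrightarrow> j \<in> {1..m} \<Longrightarrow> 0 \<le> \<tau> i j"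
    and prices_nonempty: "j \<in> {1..m} \<Longrightarrow> 1 \<le> K j"
    and price_pos: "j \<in> {1..m} \<Longrightarrow> k \<in> {1..K j} \<Longrightarrow> 0 < p j k"
    and price_strict_mono: "j \<in> {1..m} \<Longrightarrow> strict_mono_on {1..K j} (p j)"
    and order_distinct: "i \<in> {1..n} \<Longrightarrow> distinct (\<sigma> i)"
    and order_set: "i \<in> {1..n} \<Longrightarrow> set (\<sigma> i) = (SIGMA j:{1..m}. {1..K j})"
    and order_bang_per_buck: "i \<in> {1..n} \<Longrightarrow>
      sorted_wrt (\<lambda>(j, k) (j', k'). \<tau> i j / p j k \<ge> \<tau> i j' / p j' k') (\<sigma> i)"

definition profiles :: "nat \<Rightarrow> (nat \<Rightarrow> nat) \<Rightarrow> (nat \<Rightarrow> nat \<Rightarrow> real) set" where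
  "profiles m K = (\<Pi>\<^sub>E j\<in>{1..m}. strategy_simplex (K j))"

(* Amount of each shard bought by a buyer with dataset values v and remaining budget B who
   goes through the given list of shards, where shard (j, k) has size l j k and unit price
   p j k. *)

fun purchase :: "(nat \<Rightarrow> real) \<Rightarrow> (nat \<Rightarrow> nat \<Rightarrow> real) \<Rightarrow> (nat \<Rightarrow> nat \<Rightarrow> real) \<Rightarrow>
    real \<Rightarrow> (nat \<times> nat) list \<Rightarrow> nat \<times> nat \<Rightarrow> real" where
  "purchase v p l B [] = (\<lambda>_. 0)"
| "purchase v p l B ((j, k) # s) =
    (let y = (if v j > 0 then min (l j k) (B / p j k) else 0)
     in (purchase v p l (B - p j k * y) s)((j, k) := y))"

definition revenue :: "nat \<Rightarrow> (nat \<Rightarrow> real) \<Rightarrow> (nat \<Rightarrow> nat \<Rightarrow> real) \<Rightarrow> (nat \<Rightarrow> nat) \<Rightarrow>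
    (nat \<Rightarrow> nat \<Rightarrow> real) \<Rightarrow> (nat \<Rightarrow> (nat \<times> nat) list) \<Rightarrow> nat \<Rightarrow> (nat \<Rightarrow> nat \<Rightarrow> real) \<Rightarrow> real" where
  "revenue n b \<tau> K p \<sigma> j l =
    (\<Sum>i=1..n. \<Sum>k=1..K j. p j k * purchase (\<tau> i) p l (b i) (\<sigma> i) (j, k))"

end

(* Linearize the revenue of seller j in her own strategy: let g j k be her revenue when she deviates
   to the linear price k while the others keep their strategies. Brouwer's theorem, applied to Nash's
   improvement map on the product of the simplices, gives a profile l at which every g j k is at most
   the average of g j h over h with weights l j h.

   This average is at most twice the revenue of j at l, buyer by buyer. If T is the total payment of
   the buyer to j, and d k her payment to j after the deviation to price k, then the sum of
   l j k * max (d k - T) 0 is at most T: the price k contributes only if the buyer still has money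
   left over beyond T when she reaches shard (j, k), even without her purchases from j, so she has
   bought that shard entirely, for p j k * l j k, whereas d k is at most p j k. *)

theory Submission
  imports Defs
begin

section \<open>Brouwer's fixed point theorem on a cube\<close>

text \<open>Pinning all coordinates outside \<open>I\<close> to 0 lets cubes of every dimension
  share one function type and keeps them compact in the product topology.\<close>

definition unit_cube :: "'a set \<Rightarrow> ('a \<Rightarrow> real) set" where
  "unit_cube I = {x. (\<forall>i\<in>I. 0 \<le> x i \<and> x i \<le> 1) \<and> (\<forall>i. i \<notin> I \<longrightarrow> x i = 0)}"

lemma unit_cubeD:
  assumes "x \<in> unit_cube I"
  shows "0 \<le> x i" "x i \<le> 1" "i \<notin> I \<Longrightarrow> x i = 0"
  using assms unfolding unit_cube_def by (cases "i \<in> I"; force)+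

lemma compact_unit_cube: "compact (unit_cube I)"
proof -
  have "unit_cube I = Pi\<^sub>E UNIV (\<lambda>i. if i \<in> I then {0..1} else {0})"
    by (auto simp: unit_cube_def Pi_iff split: if_splits)
  moreover have "compactin (product_topology (\<lambda>_. euclidean) UNIV)
      (Pi\<^sub>E UNIV (\<lambda>i::'a. if i \<in> I then {0..1::real} else {0}))"
    unfolding compactin_PiE by auto
  ultimately show ?thesis
    by (simp add: euclidean_product_topology)
qed

lemma tendsto_fun_iff:
  fixes X :: "nat \<Rightarrow> 'a \<Rightarrow> 'b::topological_space"
  shows "X \<longlonglongrightarrow> x \<longleftrightarrow> (\<forall>i. (\<lambda>t. X t i) \<longlonglongrightarrow> x i)"
  unfolding limitin_canonical_iff[symmetric] euclidean_product_topology[symmetric]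
  by (simp add: limitin_componentwise)

text \<open>Kuhn's lemma, a cubical form of Sperner's, applied to the grid of mesh 1 /
  \<open>P\<close>. The point \<open>x\<close> is the lower corner of a cell having, for each
  coordinate \<open>a\<close>, a corner \<open>y\<close> that \<open>f\<close> does not push down
  and a corner \<open>z\<close> that it does not push up in that coordinate.\<close>

lemma approximate_fixpoint_unit_cube:
  fixes f :: "('a \<Rightarrow> real) \<Rightarrow> 'a \<Rightarrow> real"
  assumes "finite I" and f: "\<And>x. x \<in> unit_cube I \<Longrightarrow> f x \<in> unit_cube I" and "0 < P"
  shows "\<exists>x\<in>unit_cube I. \<forall>a\<in>I. \<exists>y\<in>unit_cube I. \<exists>z\<in>unit_cube I.
    (\<forall>c. \<bar>y c - x c\<bar> \<le> 1 / real P \<and> \<bar>z c - x c\<bar> \<le> 1 / real P) \<and> y a \<le> f y a \<and> f z a \<le> z a"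
proof -
  define N where "N = card I"
  obtain h where h: "bij_betw h {..<N} I"
    using ex_bij_betw_nat_finite[OF \<open>finite I\<close>] unfolding N_def atLeast0LessThan by blast
  define e where "e = inv_into {..<N} h"
  have eI: "e a < N" "h (e a) = a" if "a \<in> I" for a
    using that h bij_betw_inv_into_right[OF h] bij_betwE[OF bij_betw_inv_into[OF h]]
    unfolding e_def by auto
  define pt where "pt q = (\<lambda>a. if a \<in> I then real (q (e a)) / real P else 0)" for q :: "nat \<Rightarrow> nat"
  have pt_cube: "pt q \<in> unit_cube I" if "\<forall>i<N. q i \<le> P" for q
    using that eI \<open>0 < P\<close> by (auto simp: pt_def unit_cube_def divide_simps)
  \<comment> \<open>Label 0 stands for "not pushed down", label 1 for "not pushed up". The labels
    that \<open>kuhn_lemma\<close> prescribes on opposite faces keep this meaning, since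
    \<open>f\<close> stays in the cube.\<close>
  define label where "label q i = (if q i = P then 1 else if q i = 0 then 0
    else if pt q (h i) \<le> f (pt q) (h i) then 0 else 1 :: nat)" for q i
  obtain q where qP: "\<forall>i<N. q i < P" and q: "\<forall>i<N. \<exists>r s. (\<forall>j<N. q j \<le> r j \<and> r j \<le> q j + 1) \<and>
      (\<forall>j<N. q j \<le> s j \<and> s j \<le> q j + 1) \<and> label r i \<noteq> label s i"
    by (rule kuhn_lemma[of P N label]) (use \<open>0 < P\<close> in \<open>auto simp: label_def\<close>)
  have label0: "pt r a \<le> f (pt r) a" if "\<forall>i<N. r i \<le> P" "a \<in> I" "label r (e a) = 0" for r a
    using that eI[of a] unit_cubeD(1)[OF f[OF pt_cube[OF that(1)]], of a]
    by (auto simp: label_def pt_def split: if_splits)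
  have label1: "f (pt r) a \<le> pt r a" if "\<forall>i<N. r i \<le> P" "a \<in> I" "label r (e a) \<noteq> 0" for r a
    using that eI[of a] unit_cubeD(2)[OF f[OF pt_cube[OF that(1)]], of a] \<open>0 < P\<close>
    by (auto simp: label_def pt_def split: if_splits)
  have near: "\<bar>pt r c - pt q c\<bar> \<le> 1 / real P" if "\<forall>j<N. q j \<le> r j \<and> r j \<le> q j + 1" for r c
  proof (cases "c \<in> I")
    case True
    then have "q (e c) \<le> r (e c)" "r (e c) \<le> q (e c) + 1"
      using that eI by auto
    then have "\<bar>real (r (e c)) - real (q (e c))\<bar> \<le> 1" by linarith
    then show ?thesis using True \<open>0 < P\<close>
      by (simp add: pt_def diff_divide_distrib[symmetric] divide_right_mono)
  qed (simp add: pt_def)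
  show ?thesis
  proof (rule bexI[of _ "pt q"], rule ballI)
    fix a assume a: "a \<in> I"
    obtain r s where r: "\<forall>j<N. q j \<le> r j \<and> r j \<le> q j + 1"
      and s: "\<forall>j<N. q j \<le> s j \<and> s j \<le> q j + 1" and rs: "label r (e a) = 0" "label s (e a) \<noteq> 0"
    proof -
      have *: "label r (e a) = 0 \<or> label r (e a) = 1" for r by (simp add: label_def)
      obtain r s where "\<forall>j<N. q j \<le> r j \<and> r j \<le> q j + 1" "\<forall>j<N. q j \<le> s j \<and> s j \<le> q j + 1"
        "label r (e a) \<noteq> label s (e a)"
        using q eI(1)[OF a] by blast
      then show ?thesis using that[of r s] that[of s r] *[of r] *[of s] by auto
    qed
    \<comment> \<open>The strict bound \<open>q i < P\<close> keeps corners with entries up to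
      \<open>q i + 1\<close> in the grid.\<close>
    have bd: "\<forall>i<N. r i \<le> P" "\<forall>i<N. s i \<le> P"
      using r s qP by (metis Suc_eq_plus1 Suc_leI le_trans)+
    show "\<exists>y\<in>unit_cube I. \<exists>z\<in>unit_cube I. (\<forall>c. \<bar>y c - pt q c\<bar> \<le> 1 / real P \<and>
        \<bar>z c - pt q c\<bar> \<le> 1 / real P) \<and> y a \<le> f y a \<and> f z a \<le> z a"
      using near[OF r] near[OF s] label0[OF bd(1) a rs(1)] label1[OF bd(2) a rs(2)]
        pt_cube[OF bd(1)] pt_cube[OF bd(2)] by blast
  next
    show "pt q \<in> unit_cube I" using pt_cube qP by (simp add: less_imp_le)
  qed
qed

text \<open>Refine the grid: a subsequence of the approximate fixed points converges, and continuity
  gives both inequalities between \<open>f x a\<close> and \<open>x a\<close>. The countable index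
  type makes the function space first countable, so that compactness implies sequential
  compactness.\<close>

lemma brouwer_unit_cube:
  fixes f :: "('a::countable \<Rightarrow> real) \<Rightarrow> 'a \<Rightarrow> real"
  assumes "finite I" and cont: "continuous_on (unit_cube I) f"
    and f: "\<And>x. x \<in> unit_cube I \<Longrightarrow> f x \<in> unit_cube I"
  obtains x where "x \<in> unit_cube I" "f x = x"
proof -
  have "\<forall>t. \<exists>x. x \<in> unit_cube I \<and> (\<forall>a\<in>I. \<exists>y\<in>unit_cube I. \<exists>z\<in>unit_cube I.
    (\<forall>c. \<bar>y c - x c\<bar> \<le> 1 / real (Suc t) \<and> \<bar>z c - x c\<bar> \<le> 1 / real (Suc t)) \<and>
    y a \<le> f y a \<and> f z a \<le> z a)"
    using approximate_fixpoint_unit_cube[of I f, OF \<open>finite I\<close> f] unfolding Bex_def[of "unit_cube I"]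
    by (metis zero_less_Suc)
  then obtain X where X: "\<And>t. X t \<in> unit_cube I"
    and near: "\<And>t. \<forall>a\<in>I. \<exists>y\<in>unit_cube I. \<exists>z\<in>unit_cube I.
    (\<forall>c. \<bar>y c - X t c\<bar> \<le> 1 / real (Suc t) \<and> \<bar>z c - X t c\<bar> \<le> 1 / real (Suc t)) \<and>
    y a \<le> f y a \<and> f z a \<le> z a"
    by metis
  obtain x \<phi> where x: "x \<in> unit_cube I" "strict_mono \<phi>" "(X \<circ> \<phi>) \<longlonglongrightarrow> x"
    using compact_imp_seq_compact[OF compact_unit_cube[of I]] X unfolding seq_compact_def by blast
  have small: "(\<lambda>t. 1 / real (Suc (\<phi> t))) \<longlonglongrightarrow> 0"
    using LIMSEQ_subseq_LIMSEQ[OF LIMSEQ_inverse_real_of_nat x(2)]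
    by (simp add: o_def inverse_eq_divide)
  have lim: "Y \<longlonglongrightarrow> x" if "\<And>t c. \<bar>Y t c - X (\<phi> t) c\<bar> \<le> 1 / real (Suc (\<phi> t))" for Y
    unfolding tendsto_fun_iff
  proof
    fix c
    have "(\<lambda>t. Y t c - X (\<phi> t) c) \<longlonglongrightarrow> 0"
      by (rule Lim_null_comparison[OF _ small]) (use that in auto)
    moreover have "(\<lambda>t. X (\<phi> t) c) \<longlonglongrightarrow> x c"
      using x(3) unfolding tendsto_fun_iff o_def by blast
    ultimately show "(\<lambda>t. Y t c) \<longlonglongrightarrow> x c"
      using tendsto_add by fastforce
  qed
  have flim: "(\<lambda>t. f (Y t) c) \<longlonglongrightarrow> f x c" if "\<And>t. Y t \<in> unit_cube I" "Y \<longlonglongrightarrow> x" for Y c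
  proof -
    have "(\<lambda>t. f (Y t)) \<longlonglongrightarrow> f x"
      by (rule continuous_on_tendsto_compose[OF cont that(2) x(1)]) (use that in auto)
    then show ?thesis unfolding tendsto_fun_iff by blast
  qed
  have "f x a = x a" for a
  proof (cases "a \<in> I")
    case True
    \<comment> \<open>The witnesses depend on the coordinate, so their sequences are chosen for each
      \<open>a\<close> separately.\<close>
    then have "\<forall>t. \<exists>y z. y \<in> unit_cube I \<and> z \<in> unit_cube I \<and>
      (\<forall>c. \<bar>y c - X (\<phi> t) c\<bar> \<le> 1 / real (Suc (\<phi> t)) \<and> \<bar>z c - X (\<phi> t) c\<bar> \<le> 1 / real (Suc (\<phi> t))) \<and>
      y a \<le> f y a \<and> f z a \<le> z a"
      using near by blast
    then obtain Y Z where Y: "\<And>t. Y t \<in> unit_cube I" "\<And>t c. \<bar>Y t c - X (\<phi> t) c\<bar> \<le> 1 / real (Suc (\<phi> t))"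
      "\<And>t. Y t a \<le> f (Y t) a" and Z: "\<And>t. Z t \<in> unit_cube I"
      "\<And>t c. \<bar>Z t c - X (\<phi> t) c\<bar> \<le> 1 / real (Suc (\<phi> t))" "\<And>t. f (Z t) a \<le> Z t a"
      by metis
    have "(\<lambda>t. Y t a) \<longlonglongrightarrow> x a" "(\<lambda>t. Z t a) \<longlonglongrightarrow> x a"
      using lim[OF Y(2)] lim[OF Z(2)] unfolding tendsto_fun_iff by blast+
    then have "x a \<le> f x a" "f x a \<le> x a"
      using flim[OF Y(1) lim[OF Y(2)], of a] flim[OF Z(1) lim[OF Z(2)], of a] Y(3) Z(3)
      by (meson LIMSEQ_le)+
    then show ?thesis by simp
  qed (use unit_cubeD(3)[OF x(1)] unit_cubeD(3)[OF f[OF x(1)]] in auto)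
  then show ?thesis using that x(1) by blast
qed

section \<open>Payments of a single buyer\<close>

text \<open>Tracking money instead of amounts removes the division by prices, and adding up along
  the list suits induction over the shard ordering.\<close>

fun payment :: "nat \<Rightarrow> (nat \<Rightarrow> real) \<Rightarrow> (nat \<Rightarrow> nat \<Rightarrow> real) \<Rightarrow> (nat \<Rightarrow> nat \<Rightarrow> real) \<Rightarrow>
    real \<Rightarrow> (nat \<times> nat) list \<Rightarrow> real" where
  "payment j v p l B [] = 0"
| "payment j v p l B ((i, h) # s) =
    (let x = (if v i > 0 then min (p i h * l i h) B else 0)
     in (if i = j then x else 0) + payment j v p l (B - x) s)"

lemma mult_min_divide: "0 < (q::real) \<Longrightarrow> q * min x (B / q) = min (q * x) B"
  by (simp add: min_def field_simps)

lemma purchase_outside: "jk \<notin> set s \<Longrightarrow> purchase v p l B s jk = 0"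
  by (induction v p l B s rule: purchase.induct) (auto simp: Let_def)

text \<open>Without repetitions in the list, the function update in \<open>purchase\<close> never
  overwrites the purchase of a later shard, so the two recursions agree step by step. Indices in
  \<open>A\<close> that are not shards of \<open>j\<close> in the list contribute 0.\<close>

lemma sum_purchase_eq_payment:
  assumes "distinct s" "finite A" "{k. (j, k) \<in> set s} \<subseteq> A" "\<And>i k. (i, k) \<in> set s \<Longrightarrow> 0 < p i k"
  shows "(\<Sum>k\<in>A. p j k * purchase v p l B s (j, k)) = payment j v p l B s"
  using assms
proof (induction s arbitrary: B)
  case (Cons ih s)
  obtain i h where ih: "ih = (i, h)" by (cases ih)
  define x where "x = (if v i > 0 then min (p i h * l i h) B else 0)"
  define y where "y = (if v i > 0 then min (l i h) (B / p i h) else 0)"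
  have xy: "p i h * y = x"
    using Cons.prems(4) ih by (auto simp: x_def y_def mult_min_divide)
  have IH: "(\<Sum>k\<in>A. p j k * purchase v p l (B - x) s (j, k)) = payment j v p l (B - x) s"
    using Cons by auto
  have out: "purchase v p l (B - x) s (i, h) = 0"
    using Cons.prems ih by (intro purchase_outside) auto
  have "purchase v p l B (ih # s) = (purchase v p l (B - x) s)((i, h) := y)"
    by (simp add: ih Let_def y_def[symmetric] xy)
  then have "p j k * purchase v p l B (ih # s) (j, k) =
      (if h = k then if i = j then x else 0 else 0) + p j k * purchase v p l (B - x) s (j, k)" for k
    using out xy by auto
  then have "(\<Sum>k\<in>A. p j k * purchase v p l B (ih # s) (j, k)) =
      (\<Sum>k\<in>A. if h = k then if i = j then x else 0 else 0) + payment j v p l (B - x) s"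
    by (simp add: sum.distrib IH)
  also have "(\<Sum>k\<in>A. if h = k then if i = j then x else 0 else 0) = (if i = j then x else 0)"
    using Cons.prems ih by (auto simp: sum.delta)
  finally show ?case by (simp add: ih Let_def x_def)
qed simp

text \<open>The budget is a function of the parameter too, because what is left after the first
  shard depends on it.\<close>

lemma continuous_on_payment:
  assumes "\<And>i k. (i, k) \<in> set s \<Longrightarrow> continuous_on S (\<lambda>u. L u i k)" "continuous_on S B"
  shows "continuous_on S (\<lambda>u. payment j v p (L u) (B u) s)"
  using assms
proof (induction s arbitrary: B)
  case (Cons ih s)
  obtain i h where ih: "ih = (i, h)" by (cases ih)
  define x where "x u = (if v i > 0 then min (p i h * L u i h) (B u) else 0)" for u
  have x: "continuous_on S x"
    using Cons.prems ih unfolding x_def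
    by (cases "v i > 0") (auto intro!: continuous_intros)
  have "continuous_on S (\<lambda>u. payment j v p (L u) (B u - x u) s)"
    using Cons.prems x by (intro Cons.IH continuous_intros) auto
  with x have "continuous_on S (\<lambda>u. (if i = j then x u else 0) + payment j v p (L u) (B u - x u) s)"
    by (cases "i = j") (auto intro!: continuous_intros)
  then show ?case
    by (simp add: ih Let_def x_def[symmetric])
qed simp

text \<open>Applied after a linear deviation, once the only nonempty shard of \<open>j\<close> is
  passed. Budgets must stay nonnegative, since a negative one would win the minimum and count as a
  payment.\<close>

lemma payment_zero:
  assumes "0 \<le> B" "\<And>i k. (i, k) \<in> set s \<Longrightarrow> 0 < p i k" "\<And>k. (j, k) \<in> set s \<Longrightarrow> l j k = 0"
    "\<And>i k. (i, k) \<in> set s \<Longrightarrow> 0 \<le> l i k"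
  shows "payment j v p l B s = 0"
  using assms
proof (induction s arbitrary: B)
  case (Cons ih s)
  obtain i h where ih: "ih = (i, h)" by (cases ih)
  define x where "x = (if v i > 0 then min (p i h * l i h) B else 0)"
  have "0 \<le> p i h * l i h"
    using Cons.prems ih by (intro mult_nonneg_nonneg[OF less_imp_le]) auto
  then have x: "0 \<le> x" "x \<le> B" using Cons.prems(1) by (auto simp: x_def)
  then have "payment j v p l (B - x) s = 0"
    using Cons.prems by (intro Cons.IH) auto
  moreover have "x = 0" if "i = j"
    using Cons.prems ih that by (auto simp: x_def)
  ultimately show ?case by (auto simp: ih Let_def x_def[symmetric])
qed simp

lemma payment_nonneg:
  assumes "0 \<le> B" "\<And>i k. (i, k) \<in> set s \<Longrightarrow> 0 < p i k" "\<And>i k. (i, k) \<in> set s \<Longrightarrow> 0 \<le> l i k"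
  shows "0 \<le> payment j v p l B s"
  using assms
proof (induction s arbitrary: B)
  case (Cons ih s)
  obtain i h where ih: "ih = (i, h)" by (cases ih)
  define x where "x = (if v i > 0 then min (p i h * l i h) B else 0)"
  have "0 \<le> p i h * l i h"
    using Cons.prems ih by (intro mult_nonneg_nonneg[OF less_imp_le]) auto
  then have x: "0 \<le> x" "x \<le> B" using Cons.prems(1) by (auto simp: x_def)
  then have "0 \<le> payment j v p l (B - x) s"
    using Cons.prems by (intro Cons.IH) auto
  then show ?case using x by (auto simp: ih Let_def x_def[symmetric])
qed simp

section \<open>Gains of one seller from linear deviations\<close>

text \<open>C is the budget left when the purchases from seller j are not counted, and T0 is the amount
  already paid to seller j. The maximum of C - T0 and 0 is then the budget really left, because the
  other sellers receive no more than they would without seller j.\<close>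

lemma sum_deviation_gains_le:
  fixes j :: nat and v :: "nat \<Rightarrow> real" and l :: "nat \<Rightarrow> nat \<Rightarrow> real"
  assumes "0 \<le> C" "0 \<le> T0" "distinct s" "\<And>i k. (i, k) \<in> set s \<Longrightarrow> 0 < p i k"
    "\<And>i k. (i, k) \<in> set s \<Longrightarrow> 0 \<le> l i k"
  defines "T \<equiv> T0 + payment j v p l (max (C - T0) 0) s"
  shows "(\<Sum>k | (j, k) \<in> set s. l j k * max (payment j v p (l(j := unit_vec k)) C s - T) 0) \<le> T - T0"
  using assms(1-5) unfolding T_def
proof (induction s arbitrary: C T0)
  case (Cons jk s)
  obtain i h where jk: "jk = (i, h)" by (cases jk)
  have p: "0 < p i h" and lih: "0 \<le> l i h" and nin: "(i, h) \<notin> set s" using Cons.prems jk by auto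
  define dev where "dev k = l(j := unit_vec k)" for k
  define x where "x = (if v i > 0 then min (p i h * l i h) (max (C - T0) 0) else 0)"
  have step: "payment j v p l (max (C - T0) 0) (jk # s) = (if i = j then x else 0) +
      payment j v p l (max (C - T0) 0 - x) s"
    by (simp add: jk Let_def x_def)
  have x: "0 \<le> x" "x \<le> max (C - T0) 0" using p lih by (auto simp: x_def)
  show ?case
  proof (cases "i = j")
    case False
    \<comment> \<open>\<open>a\<close> is the payment for this shard when purchases from
      \<open>j\<close> are ignored. Either it equals the real payment \<open>x\<close>, or no real
      budget is left afterwards; in both cases the real budget is again the truncated
      difference.\<close>
    define a where "a = (if v i > 0 then min (p i h * l i h) C else 0)"
    have a: "0 \<le> a" "a \<le> C" using Cons.prems p lih by (auto simp: a_def)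
    have d: "payment j v p (dev k) C (jk # s) = payment j v p (dev k) (C - a) s" for k
      using p False by (simp add: jk Let_def a_def dev_def)
    have eq: "max (C - T0) 0 - x = max ((C - a) - T0) 0"
      using Cons.prems(1,2) mult_nonneg_nonneg[OF less_imp_le[OF p] lih] unfolding x_def a_def
      by (smt (verit))
    have "{k. (j, k) \<in> set (jk # s)} = {k. (j, k) \<in> set s}" using False jk by auto
    then show ?thesis
      using Cons.IH[of "C - a" T0] Cons.prems a False
      unfolding dev_def[symmetric] d step eq by auto
  next
    case True
    \<comment> \<open>\<open>C\<close> ignores this purchase from \<open>j\<close>, so only the
      amount already paid grows. The total \<open>T\<close> is the same before and after the shard,
      so the induction hypothesis measures gains against the same threshold.\<close>
    define T1 where "T1 = T0 + x"
    define T where "T = T1 + payment j v p l (max (C - T1) 0) s"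
    have rest: "max (C - T0) 0 - x = max (C - T1) 0"
      using x by (auto simp: T1_def max_def)
    have T: "T0 + payment j v p l (max (C - T0) 0) (jk # s) = T"
      unfolding step rest T_def using True by (simp add: T1_def)
    have "0 \<le> payment j v p l (max (C - T1) 0) s"
      using Cons.prems by (intro payment_nonneg) auto
    then have TT: "T1 \<le> T" by (simp add: T_def)
    have d: "payment j v p (dev k) C (jk # s) = payment j v p (dev k) C s" if "k \<noteq> h" for k
      using p True that Cons.prems by (simp add: jk Let_def dev_def unit_vec_def)
    \<comment> \<open>Under price \<open>h\<close> this shard has size 1 and the later shards of
      \<open>j\<close> are empty, so \<open>z\<close> is all that \<open>j\<close> receives from
      here on.\<close>
    define z where "z = (if v j > 0 then min (p j h) C else 0)"
    have z: "z \<le> C" "0 \<le> z" using p Cons.prems(1) True by (auto simp: z_def)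
    have "payment j v p (dev h) C (jk # s) = z + payment j v p (dev h) (C - z) s"
      using p True by (simp add: jk Let_def z_def dev_def unit_vec_def)
    also have "payment j v p (dev h) (C - z) s = 0"
      using Cons.prems z nin True by (intro payment_zero) (auto simp: dev_def unit_vec_def)
    finally have dh: "payment j v p (dev h) C (jk # s) = z" by simp
    \<comment> \<open>From \<open>z > T\<close> follows \<open>C > T \<ge> T0 + x\<close>, so the
      budget is not the smaller term in the minimum defining \<open>x\<close>.\<close>
    have head: "l j h * max (z - T) 0 \<le> x"
    proof (cases "z \<le> T")
      case False
      then have v: "v j > 0" and zp: "z \<le> p j h" and "T < C"
        using z TT x Cons.prems(2) by (auto simp: z_def T1_def split: if_splits)
      then have "x = p j h * l j h"
        using TT True by (auto simp: x_def T1_def min_def max_def split: if_splits)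
      moreover have "z - T \<le> p j h" using zp TT x Cons.prems(2) by (simp add: T1_def)
      ultimately show ?thesis
        using mult_left_mono[of "z - T" "p j h" "l j h"] lih True False by (simp add: mult.commute)
    qed (use x in simp)
    have A: "{k. (j, k) \<in> set (jk # s)} = insert h {k. (j, k) \<in> set s}" "h \<notin> {k. (j, k) \<in> set s}"
      using True jk nin by auto
    have fin: "finite {k. (j, k) \<in> set s}"
      by (rule finite_subset[of _ "snd ` set s"]) force+
    have tail: "(\<Sum>k | (j, k) \<in> set s. l j k * max (payment j v p (dev k) C s - T) 0) \<le> T - T1"
      unfolding T_def dev_def
      by (rule Cons.IH) (use Cons.prems x in \<open>auto simp: T1_def\<close>)
    have "(\<Sum>k | (j, k) \<in> set s. l j k * max (payment j v p (dev k) C (jk # s) - T) 0) =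
        (\<Sum>k | (j, k) \<in> set s. l j k * max (payment j v p (dev k) C s - T) 0)"
      using A(2) d by (intro sum.cong refl) (metis (no_types))
    then have "(\<Sum>k | (j, k) \<in> set (jk # s). l j k * max (payment j v p (dev k) C (jk # s) - T) 0) =
        l j h * max (z - T) 0 + (\<Sum>k | (j, k) \<in> set s. l j k * max (payment j v p (dev k) C s - T) 0)"
      unfolding A(1) sum.insert[OF fin A(2)] dh by simp
    also have "\<dots> \<le> x + (T - T1)" using head tail by simp
    also have "\<dots> = T - T0" by (simp add: T1_def)
    finally show ?thesis unfolding T dev_def .
  qed
qed simp

text \<open>Each deviation payment is at most \<open>T\<close> plus its gain over \<open>T\<close>.
  The weights sum to 1, so \<open>T\<close> averages to itself, and the average gain is at most
  \<open>T\<close> by the preceding bound, started with full budget and nothing yet paid.\<close>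

lemma sum_deviation_payments_le:
  fixes l :: "nat \<Rightarrow> nat \<Rightarrow> real"
  assumes "0 \<le> B" "distinct s" "\<And>i k. (i, k) \<in> set s \<Longrightarrow> 0 < p i k"
    and l: "\<And>i k. (i, k) \<in> set s \<Longrightarrow> 0 \<le> l i k"
    and A: "A = {k. (j, k) \<in> set s}" and one: "(\<Sum>k\<in>A. l j k) = 1"
  shows "(\<Sum>k\<in>A. l j k * payment j v p (l(j := unit_vec k)) B s) \<le> 2 * payment j v p l B s"
proof -
  define T where "T = payment j v p l B s"
  have "(\<Sum>k\<in>A. l j k * payment j v p (l(j := unit_vec k)) B s) \<le>
      (\<Sum>k\<in>A. l j k * T + l j k * max (payment j v p (l(j := unit_vec k)) B s - T) 0)"
    using l A by (intro sum_mono) (auto simp: distrib_left[symmetric] intro!: mult_left_mono)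
  also have "\<dots> = T + (\<Sum>k\<in>A. l j k * max (payment j v p (l(j := unit_vec k)) B s - T) 0)"
    using one by (simp add: sum.distrib sum_distrib_right[symmetric])
  also have "\<dots> \<le> T + T"
    using sum_deviation_gains_le[of B 0 s p l j v] assms by (simp add: T_def)
  finally show ?thesis by (simp add: T_def)
qed

section \<open>Nash's improvement map\<close>

text \<open>The summand \<open>\<psi>\<close> extends Nash's improvement map from the simplex to the cube: it keeps the
  denominator positive and vanishes at every fixed point.\<close>

lemma simplex_fixpoint_imp_best_response:
  fixes u g :: "'a \<Rightarrow> real"
  assumes "finite A" "A \<noteq> {}" and u: "\<And>k. k \<in> A \<Longrightarrow> 0 \<le> u k"
  defines "\<phi> \<equiv> \<lambda>k. max (g k - (\<Sum>h\<in>A. u h * g h)) 0" and "\<psi> \<equiv> max (1 - sum u A) 0"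
  assumes fix_eq: "\<And>k. k \<in> A \<Longrightarrow> u k = (u k + \<phi> k + \<psi>) / (\<Sum>h\<in>A. u h + \<phi> h + \<psi>)"
  shows "sum u A = 1" and "k \<in> A \<Longrightarrow> g k \<le> (\<Sum>h\<in>A. u h * g h)"
proof -
  define D where "D = (\<Sum>h\<in>A. u h + \<phi> h + \<psi>)"
  define avg where "avg = (\<Sum>h\<in>A. u h * g h)"
  have \<phi>: "0 \<le> \<phi> k" and "0 \<le> \<psi>" for k by (auto simp: \<phi>_def \<psi>_def)
  \<comment> \<open>Since division by zero yields 0, \<open>D = 0\<close> would force
    \<open>u\<close> to vanish on \<open>A\<close>; then \<open>\<psi>\<close> is 1 and every
    summand of \<open>D\<close> is positive.\<close>
  have "D \<noteq> 0"
  proof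
    assume "D = 0"
    then have "\<forall>k\<in>A. u k = 0" using fix_eq unfolding D_def[symmetric] by simp
    then have "\<psi> = 1" by (simp add: \<psi>_def)
    moreover have "\<forall>h\<in>A. u h + \<phi> h + \<psi> = 0"
      using \<open>D = 0\<close> u \<phi> \<open>0 \<le> \<psi>\<close> \<open>finite A\<close> unfolding D_def by (subst (asm) sum_nonneg_eq_0_iff) auto
    ultimately show False using u \<phi> \<open>A \<noteq> {}\<close> by (metis add_nonneg_pos add_nonneg_nonneg ex_in_conv less_irrefl zero_less_one)
  qed
  have "sum u A = (\<Sum>k\<in>A. (u k + \<phi> k + \<psi>) / D)"
    using fix_eq unfolding D_def[symmetric] by (intro sum.cong) auto
  also have "\<dots> = 1"
    using \<open>D \<noteq> 0\<close> by (simp add: sum_divide_distrib[symmetric] D_def)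
  finally show one: "sum u A = 1" .
  then have "\<psi> = 0" by (simp add: \<psi>_def)
  then have D: "D = 1 + sum \<phi> A" using one by (simp add: D_def sum.distrib)
  have scaled: "u k * sum \<phi> A = \<phi> k" if "k \<in> A" for k
    using fix_eq[OF that] \<open>D \<noteq> 0\<close> \<open>\<psi> = 0\<close> unfolding D_def[symmetric] by (simp add: D field_simps)
  \<comment> \<open>Some value of positive weight does not exceed the weighted average. Its gain is
    0, so \<open>scaled\<close> forces the sum of all gains to be 0.\<close>
  have "\<exists>k\<in>A. 0 < u k \<and> g k \<le> avg"
  proof (rule ccontr)
    assume "\<not> (\<exists>k\<in>A. 0 < u k \<and> g k \<le> avg)"
    then have less: "avg < g k" if "k \<in> A" "0 < u k" for k using that by force
    obtain k where k: "k \<in> A" "0 < u k"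
      using one u by (metis less_eq_real_def sum.neutral zero_neq_one)
    have "(\<Sum>k\<in>A. u k * avg) < (\<Sum>k\<in>A. u k * g k)"
    proof (rule sum_strict_mono_ex1[OF \<open>finite A\<close>])
      show "\<forall>k\<in>A. u k * avg \<le> u k * g k"
        using u less by (metis less_eq_real_def mult_left_mono mult_zero_left)
      show "\<exists>k\<in>A. u k * avg < u k * g k"
        using k less by (intro bexI[of _ k]) auto
    qed
    then show False using one by (simp add: sum_distrib_right[symmetric] avg_def)
  qed
  then obtain k0 where "k0 \<in> A" "0 < u k0" "g k0 \<le> avg" by blast
  then have "sum \<phi> A = 0"
    using scaled[of k0] by (simp add: \<phi>_def avg_def)
  then show "g k \<le> (\<Sum>h\<in>A. u h * g h)" if "k \<in> A"
    using scaled[OF that] by (simp add: \<phi>_def max_def split: if_splits)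
qed

text \<open>Nash's map acts on all blocks \<open>j\<close> at once, with one coordinate per pair
  \<open>(j, k)\<close>. Extended to the cube, it falls under the cube version of Brouwer's theorem,
  and its fixed points have block sums 1.\<close>

lemma best_response_profile:
  fixes g :: "'i::countable \<Rightarrow> 'k::countable \<Rightarrow> ('i \<times> 'k \<Rightarrow> real) \<Rightarrow> real"
  assumes "finite J" "\<And>j. j \<in> J \<Longrightarrow> finite (A j)" "\<And>j. j \<in> J \<Longrightarrow> A j \<noteq> {}"
    and g: "\<And>j k. j \<in> J \<Longrightarrow> k \<in> A j \<Longrightarrow> continuous_on (unit_cube (Sigma J A)) (g j k)"
  obtains u where "u \<in> unit_cube (Sigma J A)" "\<And>j. j \<in> J \<Longrightarrow> (\<Sum>k\<in>A j. u (j, k)) = 1"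
    "\<And>j k. j \<in> J \<Longrightarrow> k \<in> A j \<Longrightarrow> g j k u \<le> (\<Sum>h\<in>A j. u (j, h) * g j h u)"
proof -
  define \<phi> where "\<phi> j k u = max (g j k u - (\<Sum>h\<in>A j. u (j, h) * g j h u)) 0" for j k u
  define \<psi> where "\<psi> j u = max (1 - (\<Sum>h\<in>A j. u (j, h))) 0" for j and u :: "'i \<times> 'k \<Rightarrow> real"
  define num where "num j k u = u (j, k) + \<phi> j k u + \<psi> j u" for j k u
  define f where "f u = (\<lambda>(j, k). if j \<in> J \<and> k \<in> A j then num j k u / (\<Sum>h\<in>A j. num j h u) else 0)" for u
  define C where "C = unit_cube (Sigma J A)"
  note C = unit_cubeD[where I = "Sigma J A", folded C_def]
  have num: "0 \<le> num j k u" if "u \<in> C" for j k u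
    using C(1)[OF that] by (simp add: num_def \<phi>_def \<psi>_def)
  \<comment> \<open>The deficit \<open>\<psi>\<close> tops the block sum up to at least 1, and as
    \<open>A j\<close> is nonempty it is counted at least once. This keeps the quotient
    continuous.\<close>
  have den: "1 \<le> (\<Sum>h\<in>A j. num j h u)" if "u \<in> C" "j \<in> J" for j u
  proof -
    have "1 \<le> (\<Sum>h\<in>A j. u (j, h)) + \<psi> j u" by (simp add: \<psi>_def)
    also have "\<dots> \<le> (\<Sum>h\<in>A j. u (j, h)) + real (card (A j)) * \<psi> j u"
      using assms(2,3)[OF that(2)] by (simp add: \<psi>_def Suc_le_eq card_gt_0_iff mult_le_cancel_right1)
    also have "\<dots> \<le> (\<Sum>h\<in>A j. num j h u)"
      by (simp add: num_def sum.distrib \<phi>_def sum_nonneg)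
    finally show ?thesis .
  qed
  have fC: "f u \<in> C" if "u \<in> C" for u
  proof -
    have "num j k u \<le> (\<Sum>h\<in>A j. num j h u)" if "j \<in> J" "k \<in> A j" for j k
      using assms(2) that num[OF \<open>u \<in> C\<close>] by (intro member_le_sum) auto
    then show ?thesis
      using num[OF that] den[OF that] unfolding C_def unit_cube_def f_def
      by (auto simp: divide_le_eq_1 intro!: divide_nonneg_nonneg) (smt (verit))+
  qed
  have coord: "continuous_on C (\<lambda>u. u i)" for i
    by (rule continuous_on_product_then_coordinatewise) (rule continuous_on_id)
  have cnum: "continuous_on C (num j k)" if "j \<in> J" "k \<in> A j" for j k
    using that g[folded C_def] unfolding num_def \<phi>_def \<psi>_def
    by (intro continuous_intros coord) auto
  have "continuous_on C f"
  proof (rule continuous_on_coordinatewise_then_product)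
    fix jk :: "'i \<times> 'k"
    obtain j k where jk: "jk = (j, k)" by (cases jk)
    show "continuous_on C (\<lambda>u. f u jk)"
    proof (cases "j \<in> J \<and> k \<in> A j")
      case True
      then have "continuous_on C (\<lambda>u. num j k u / (\<Sum>h\<in>A j. num j h u))"
        using den cnum by (intro continuous_intros) force+
      then show ?thesis using True by (simp add: f_def jk)
    next
      case False
      then have "f u jk = 0" for u by (auto simp: f_def jk)
      then show ?thesis by simp
    qed
  qed
  moreover have "finite (Sigma J A)" using assms by auto
  ultimately obtain u where u: "u \<in> C" "f u = u"
    using brouwer_unit_cube[of "Sigma J A" f] fC unfolding C_def by metis
  have fixed: "u (j, k) = num j k u / (\<Sum>h\<in>A j. num j h u)" if "j \<in> J" "k \<in> A j" for j k
    using fun_cong[OF u(2), of "(j, k)"] that by (simp add: f_def)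
  have "(\<Sum>k\<in>A j. u (j, k)) = 1" "\<And>k. k \<in> A j \<Longrightarrow> g j k u \<le> (\<Sum>h\<in>A j. u (j, h) * g j h u)"
    if "j \<in> J" for j
    using simplex_fixpoint_imp_best_response[where A = "A j" and u = "\<lambda>k. u (j, k)" and g = "\<lambda>k. g j k u",
        OF assms(2)[OF that] assms(3)[OF that] C(1)[OF u(1)] fixed[OF that, unfolded num_def \<phi>_def \<psi>_def]]
    by blast+
  then show ?thesis using that u(1) unfolding C_def by blast
qed

section \<open>Revenues in the market\<close>

context data_market
begin

lemma revenue_eq_sum_payment:
  assumes "j \<in> {1..m}"
  shows "revenue n b \<tau> K p \<sigma> j l = (\<Sum>i=1..n. payment j (\<tau> i) p l (b i) (\<sigma> i))"
  unfolding revenue_def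
  using assms order_distinct order_set price_pos
  by (intro sum.cong refl sum_purchase_eq_payment) auto

text \<open>Revenues add up over the buyers and the weights \<open>l j k\<close> are the same for
  each of them, so the one-buyer bound can be summed.\<close>

lemma sum_deviation_revenues_le:
  assumes j: "j \<in> {1..m}" and l: "\<And>j. j \<in> {1..m} \<Longrightarrow> l j \<in> strategy_simplex (K j)"
  shows "(\<Sum>k=1..K j. l j k * revenue n b \<tau> K p \<sigma> j (l(j := unit_vec k))) \<le> 2 * revenue n b \<tau> K p \<sigma> j l"
proof -
  have "(\<Sum>k=1..K j. l j k * revenue n b \<tau> K p \<sigma> j (l(j := unit_vec k))) =
      (\<Sum>i=1..n. \<Sum>k=1..K j. l j k * payment j (\<tau> i) p (l(j := unit_vec k)) (b i) (\<sigma> i))"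
    by (simp add: revenue_eq_sum_payment[OF j] sum_distrib_left) (rule sum.swap)
  also have "\<dots> \<le> (\<Sum>i=1..n. 2 * payment j (\<tau> i) p l (b i) (\<sigma> i))"
    using l j order_set order_distinct budget_nonneg price_pos
    by (intro sum_mono sum_deviation_payments_le) (auto simp: strategy_simplex_def)
  finally show ?thesis
    by (simp add: revenue_eq_sum_payment[OF j] sum_distrib_left)
qed

end

theorem theorem3:
  fixes n m :: nat
    and b :: "nat \<Rightarrow> real"
    and \<tau> :: "nat \<Rightarrow> nat \<Rightarrow> real"
    and K :: "nat \<Rightarrow> nat"
    and p :: "nat \<Rightarrow> nat \<Rightarrow> real"
    and \<sigma> :: "nat \<Rightarrow> (nat \<times> nat) list"
  assumes "data_market n m b \<tau> K p \<sigma>"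
  shows "\<exists>l \<in> profiles m K. \<forall>j \<in> {1..m}.
    Max ((\<lambda>k. revenue n b \<tau> K p \<sigma> j (l(j := unit_vec k))) ` {1..K j})
      \<le> 2 * revenue n b \<tau> K p \<sigma> j l"
proof -
  interpret data_market n m b \<tau> K p \<sigma> by fact
  define I where "I = (SIGMA j:{1..m}. {1..K j})"
  \<comment> \<open>\<open>profiles\<close> is an extensional product, hence
    \<open>restrict\<close>. Points of the cube need not give profiles, yet \<open>g\<close> below
    is defined and continuous on all of it.\<close>
  define L where "L u = restrict (\<lambda>j k. u (j, k)) {1..m}" for u :: "nat \<times> nat \<Rightarrow> real"
  define g where "g j k u = revenue n b \<tau> K p \<sigma> j ((L u)(j := unit_vec k))" for j k u
  have coord: "continuous_on (unit_cube I) (\<lambda>u. u i)" for i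
    by (rule continuous_on_product_then_coordinatewise) (rule continuous_on_id)
  have "continuous_on (unit_cube I) (g j k)" if "j \<in> {1..m}" for j k
  proof -
    have "continuous_on (unit_cube I) (\<lambda>u. ((L u)(j := unit_vec k)) i h)" if "i \<in> {1..m}" for i h
      using that coord by (cases "i = j") (auto simp: L_def)
    then show ?thesis
      unfolding g_def revenue_eq_sum_payment[OF that]
      using order_set by (intro continuous_on_sum continuous_on_payment continuous_on_const) auto
  qed
  then obtain u where u: "u \<in> unit_cube I" "\<And>j. j \<in> {1..m} \<Longrightarrow> (\<Sum>k=1..K j. u (j, k)) = 1"
    and best: "\<And>j k. j \<in> {1..m} \<Longrightarrow> k \<in> {1..K j} \<Longrightarrow> g j k u \<le> (\<Sum>h=1..K j. u (j, h) * g j h u)"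
    using best_response_profile[of "{1..m}" "\<lambda>j. {1..K j}" g] prices_nonempty
    unfolding I_def by auto
  have L: "L u j \<in> strategy_simplex (K j)" if "j \<in> {1..m}" for j
    using u that unit_cubeD[OF u(1)] by (auto simp: strategy_simplex_def L_def I_def)
  show ?thesis
  proof (intro bexI ballI)
    show "L u \<in> profiles m K"
      using L by (auto simp: profiles_def L_def)
  next
    fix j assume j: "j \<in> {1..m}"
    have "g j k u \<le> 2 * revenue n b \<tau> K p \<sigma> j (L u)" if "k \<in> {1..K j}" for k
    proof -
      have "g j k u \<le> (\<Sum>h=1..K j. u (j, h) * g j h u)"
        by (rule best[OF j that])
      also have "\<dots> = (\<Sum>h=1..K j. L u j h * revenue n b \<tau> K p \<sigma> j ((L u)(j := unit_vec h)))"
        using j by (intro sum.cong) (auto simp: g_def L_def)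
      also have "\<dots> \<le> 2 * revenue n b \<tau> K p \<sigma> j (L u)"
        by (rule sum_deviation_revenues_le[OF j L])
      finally show ?thesis .
    qed
    then show "Max ((\<lambda>k. revenue n b \<tau> K p \<sigma> j ((L u)(j := unit_vec k))) ` {1..K j})
        \<le> 2 * revenue n b \<tau> K p \<sigma> j (L u)"
      using prices_nonempty[OF j] unfolding g_def by (subst Max_le_iff) auto
  qed
qed

end
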